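(* Let $q$ be a power of an odd prime and let $C$ be a Golomb-Costas array of order $q-2$, with $\#(e,e)$, $\#(o,o)$, $\#(e,o)$, $\#(o,e)$ its numbers of even/even, odd/odd, even/odd and odd/even dots. If $q\equiv 1\pmod 4$, then $\#(e,e)=(q-5)/4$ and $\#(o,o)=\#(e,o)=\#(o,e)=(q-1)/4$. If $q\equiv 3\pmod 4$, then $\#(e,e)=\#(e,o)=\#(o,e)=(q-3)/4$ and $\#(o,o)=(q+1)/4$.
   Context: $\mathbb{F}_q$ is the finite field with $q$ elements and $\mathbb{F}_q^*$ its cyclic multiplicative group. Given generators $\alpha,\beta$ of $\mathbb{F}_q^*$ (possibly $\alpha=\beta$), the Golomb-Costas array of order $q-2$ is the $(q-2)\times(q-2)$ array with a dot in position $(i,j)$ (row $i$, column $j$, $1\le i,j\le q-2$) exactly when $\alpha^i+\beta^j=1$. A dot in row $i$, column $j$ is even/even if $i,j$ are both even, odd/odd if both are odd, even/odd if $i$ is even and $j$ odd, odd/even if $i$ is odd and $j$ even. *)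

theory Defs
  imports Main Complex_Main "HOL-Library.Cardinality" "HOL-Number_Theory.Cong"
    "HOL-Computational_Algebra.Primes"
begin

definition mult_generator :: "'a::field \<Rightarrow> bool" where
  "mult_generator a \<longleftrightarrow> a \<noteq> 0 \<and> range (\<lambda>k::int. a powi k) = UNIV - {0}"

text \<open>An array is represented by the set of positions (row, column) of its dots.\<close>

definition golomb_costas_array :: "'a::{field,finite} \<Rightarrow> 'a \<Rightarrow> (nat \<times> nat) set" where
  "golomb_costas_array a b =
     {(i, j). i \<in> {1..CARD('a) - 2} \<and> j \<in> {1..CARD('a) - 2} \<and> a ^ i + b ^ j = 1}"

definition num_ee :: "(nat \<times> nat) set \<Rightarrow> nat" where
  "num_ee C = card {(i, j) \<in> C. even i \<and> even j}"

definition num_oo :: "(nat \<times> nat) set \<Rightarrow> nat" where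
  "num_oo C = card {(i, j) \<in> C. odd i \<and> odd j}"

definition num_eo :: "(nat \<times> nat) set \<Rightarrow> nat" where
  "num_eo C = card {(i, j) \<in> C. even i \<and> odd j}"

definition num_oe :: "(nat \<times> nat) set \<Rightarrow> nat" where
  "num_oe C = card {(i, j) \<in> C. odd i \<and> even j}"

end

theory Submission imports Defs "HOL-Library.FuncSet" begin

text \<open>
  With \<open>q = 2 m + 1\<close>, the quadratic character \<open>x \<mapsto> x ^ m\<close> sends the \<open>i\<close>-th power of a generator to
  \<open>(-1) ^ i\<close>, so it reads off the parity of exponents. The dots correspond to the field elements
  \<open>x \<noteq> 0, 1\<close> via \<open>x = \<alpha> ^ i\<close>, \<open>1 - x = \<beta> ^ j\<close>; let \<open>N s t\<close> count those with characters
  \<open>(s, t)\<close>. Each character value is taken by \<open>m\<close> elements, and \<open>x = 1\<close> is the only one with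
  \<open>1 - x = 0\<close>, which determines \<open>N s 1 + N s (-1)\<close>. The symmetry \<open>x \<mapsto> 1 - x\<close> gives
  \<open>N s t = N t s\<close>, and \<open>x \<mapsto> 1 / x\<close> gives \<open>N s t = N s (u * s * t)\<close> with \<open>u = (-1) ^ m\<close>, since
  \<open>1 - 1 / x = - (1 - x) / x\<close>. These linear relations determine all four counts.
\<close>

section \<open>Powers of a generator of the multiplicative group\<close>

text \<open>Multiplication by \<open>a\<close> permutes the nonzero elements, so their nonzero
  product absorbs the factor \<open>a ^ (CARD('a) - 1)\<close>.\<close>

lemma finite_field_power_eq_1:
  fixes a :: "'a::{field,finite}"
  assumes "a \<noteq> 0"
  shows "a ^ (CARD('a) - 1) = 1"
proof -
  let ?U = "UNIV - {0::'a}"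
  have "bij_betw ((*) a) ?U ?U"
    using assms by (intro bij_betwI[where g = "\<lambda>x. x / a"]) auto
  hence "(\<Prod>x\<in>?U. a * x) = \<Prod>?U"
    by (rule prod.reindex_bij_betw)
  hence "a ^ card ?U * \<Prod>?U = \<Prod>?U"
    by (simp add: prod.distrib)
  moreover have "\<Prod>?U \<noteq> 0"
    by simp
  ultimately have "a ^ card ?U = 1"
    by simp
  thus ?thesis
    by (simp add: card_Diff_singleton)
qed

text \<open>Integer exponents, negative ones included, reduce modulo \<open>CARD('a) - 1\<close>, so
  the listed powers already give every nonzero element. Equal cardinalities then force
  injectivity.\<close>

lemma mult_generator_bij_betw:
  fixes a :: "'a::{field,finite}"
  assumes "mult_generator a"
  shows "bij_betw (\<lambda>i. a ^ i) {0..<CARD('a) - 1} (UNIV - {0})"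
proof -
  let ?n = "CARD('a) - 1"
  have a: "a \<noteq> 0" and range: "range (\<lambda>k::int. a powi k) = UNIV - {0}"
    using assms by (auto simp: mult_generator_def)
  have card: "card (UNIV - {0::'a}) = ?n"
    by (simp add: card_Diff_singleton)
  have "1 \<in> UNIV - {0::'a}"
    by simp
  hence "?n > 0"
    by (metis card card_gt_0_iff finite empty_iff)
  have "(\<lambda>i. a ^ i) ` {0..<?n} = UNIV - {0}"
  proof (intro equalityI subsetI)
    fix x assume "x \<in> UNIV - {0::'a}"
    then obtain k :: int where x: "x = a powi k"
      using range by blast
    define r where "r = nat (k mod int ?n)"
    have "k = int ?n * (k div int ?n) + int r"
      using \<open>?n > 0\<close> by (simp add: r_def)
    hence "x = a powi (int ?n * (k div int ?n)) * a powi (int r)"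
      using a x by (metis power_int_add)
    also have "\<dots> = a ^ r"
      unfolding power_int_mult power_int_of_nat finite_field_power_eq_1[OF a] by simp
    finally show "x \<in> (\<lambda>i. a ^ i) ` {0..<?n}"
      using \<open>?n > 0\<close> by (auto simp: r_def nat_less_iff)
  qed (use a in auto)
  thus ?thesis
    unfolding bij_betw_def using card by (auto intro: eq_card_imp_inj_on)
qed

text \<open>Dropping the exponent 0 removes exactly the element 1. This is the index range of the
  rows and columns of the array.\<close>

lemma mult_generator_bij_betw_non_1:
  fixes a :: "'a::{field,finite}"
  assumes "mult_generator a"
  shows "bij_betw (\<lambda>i. a ^ i) {1..CARD('a) - 2} (UNIV - {0, 1})"
proof -
  have "CARD('a) \<ge> 2"
    using card_mono[of UNIV "{0, 1::'a}"] by simp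
  have "bij_betw (\<lambda>i. a ^ i) ({0..<CARD('a) - 1} - {0}) ((UNIV - {0}) - {a ^ 0})"
    using mult_generator_bij_betw[OF assms] \<open>CARD('a) \<ge> 2\<close> by (intro bij_betw_DiffI) auto
  moreover have "{0..<CARD('a) - 1} - {0} = {1..CARD('a) - 2}"
    by auto
  moreover have "(UNIV - {0}) - {a ^ 0} = UNIV - {0, 1::'a}"
    by auto
  ultimately show ?thesis
    by simp
qed

section \<open>The quadratic character and the sizes of its fibres\<close>

context
  fixes m :: nat
  assumes card: "CARD('a::{field,finite}) = 2 * m + 1" and m: "m > 0"
begin

text \<open>\<open>a ^ m\<close> squares to 1 but differs from \<open>a ^ 0\<close>, since both
  exponents lie in the range of injectivity. So it is -1, and -1 differs from 1.\<close>

lemma mult_generator_half_power: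
  fixes a :: 'a
  assumes "mult_generator a"
  shows "a ^ m = - 1" and "(1::'a) \<noteq> - 1"
proof -
  have "a \<noteq> 0"
    using assms by (simp add: mult_generator_def)
  have "inj_on (\<lambda>i. a ^ i) {0..<2 * m}"
    using mult_generator_bij_betw[OF assms] card by (simp add: bij_betw_def)
  hence "a ^ m \<noteq> a ^ 0"
    using m by (auto dest!: inj_onD[of _ _ m 0])
  moreover have "(a ^ m)\<^sup>2 = 1"
    using finite_field_power_eq_1[OF \<open>a \<noteq> 0\<close>] card by (simp add: power_mult[symmetric] mult.commute)
  ultimately show "a ^ m = - 1" "(1::'a) \<noteq> - 1"
    by (auto simp: power2_eq_1_iff)
qed

lemma mult_generator_power_character:
  fixes a :: 'a
  assumes "mult_generator a"
  shows "(a ^ i) ^ m = 1 \<longleftrightarrow> even i" and "(a ^ i) ^ m = - 1 \<longleftrightarrow> odd i"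
proof -
  have "(a ^ i) ^ m = (- 1) ^ i"
    by (metis mult_generator_half_power(1)[OF assms] power_mult mult.commute)
  thus "(a ^ i) ^ m = 1 \<longleftrightarrow> even i" "(a ^ i) ^ m = - 1 \<longleftrightarrow> odd i"
    using mult_generator_half_power(2)[OF assms] by (auto simp: minus_one_power_iff)
qed

lemma character_cases:
  fixes x :: 'a
  assumes "x \<noteq> 0"
  shows "x ^ m = 1 \<or> x ^ m = - 1"
proof -
  have "(x ^ m)\<^sup>2 = 1"
    using finite_field_power_eq_1[OF assms] card by (simp add: power_mult[symmetric] mult.commute)
  thus ?thesis
    by (simp add: power2_eq_1_iff)
qed

text \<open>Multiplication by a generator swaps the two fibres, which together make up the
  \<open>2 * m\<close> nonzero elements.\<close>

lemma card_character_fibre: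
  fixes a s :: 'a
  assumes "mult_generator a" and s: "s = 1 \<or> s = - 1"
  shows "card {x::'a. x ^ m = s} = m"
proof -
  let ?S = "{x::'a. x ^ m = 1}" and ?N = "{x::'a. x ^ m = - 1}"
  note half = mult_generator_half_power[OF assms(1)]
  have "a \<noteq> 0"
    using assms(1) by (simp add: mult_generator_def)
  have "bij_betw ((*) a) ?S ?N"
    using \<open>a \<noteq> 0\<close> half
    by (intro bij_betwI[where g = "\<lambda>x. x / a"]) (auto simp: power_mult_distrib power_divide)
  hence eq: "card ?S = card ?N"
    by (rule bij_betw_same_card)
  have "?S \<union> ?N = UNIV - {0}"
    using character_cases m by (auto simp: power_0_left)
  moreover have "card (?S \<union> ?N) = card ?S + card ?N"
    using half(2) by (intro card_Un_disjoint) auto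
  ultimately have "card ?S + card ?N = 2 * m"
    using card by (simp add: card_Diff_singleton)
  thus ?thesis
    using s eq by auto
qed

section \<open>Counting elements by the characters of x and 1 - x\<close>

text \<open>For signs \<open>s\<close> and \<open>t\<close> the elements 0 and 1 drop out by
  themselves, because \<open>0 ^ m = 0\<close>.\<close>

definition character_count :: "'a \<Rightarrow> 'a \<Rightarrow> nat" where
  "character_count s t = card {x. x ^ m = s \<and> (1 - x) ^ m = t}"

lemma character_count_commute: "character_count s t = character_count t s"
proof -
  have "bij_betw (\<lambda>x. 1 - x) {x::'a. x ^ m = s \<and> (1 - x) ^ m = t} {x. x ^ m = t \<and> (1 - x) ^ m = s}"
    by (intro bij_betwI[where g = "\<lambda>x. 1 - x"]) auto
  thus ?thesis
    unfolding character_count_def by (rule bij_betw_same_card)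
qed

lemma character_count_inverse:
  assumes s: "s = 1 \<or> s = - 1"
  shows "character_count s t = character_count s ((- 1) ^ m * s * t)"
proof -
  let ?A = "\<lambda>t. {x::'a. x ^ m = s \<and> (1 - x) ^ m = t}"
  define u :: 'a where "u = (- 1) ^ m * s"
  \<comment> \<open>\<open>u\<close> is a sign, so twisting by it is an involution; inversion is
    therefore its own inverse between the two sets.\<close>
  have uu: "u * (u * t) = t" for t
    using s by (auto simp: u_def minus_one_power_iff)
  have maps: "inverse x \<in> ?A (u * t)" if "x \<in> ?A t" for x t
  proof -
    have "x \<noteq> 0"
      using that s m by (auto simp: power_0_left)
    hence "1 - inverse x = - 1 * (1 - x) * inverse x"
      by (simp add: field_simps)
    hence "(1 - inverse x) ^ m = (- 1) ^ m * (1 - x) ^ m * inverse (x ^ m)"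
      by (metis power_mult_distrib power_inverse)
    thus ?thesis
      using that s by (auto simp: power_inverse u_def)
  qed
  have "bij_betw inverse (?A t) (?A (u * t))"
    using maps[of _ t] maps[of _ "u * t"] by (intro bij_betwI[where g = inverse]) (auto simp: uu)
  thus ?thesis
    unfolding character_count_def u_def by (rule bij_betw_same_card)
qed

lemma character_count_add:
  fixes a s :: 'a
  assumes "mult_generator a" and s: "s = 1 \<or> s = - 1"
  shows "character_count s 1 + character_count s (- 1) = (if s = 1 then m - 1 else m)"
proof -
  let ?A = "\<lambda>t. {x::'a. x ^ m = s \<and> (1 - x) ^ m = t}"
  note neq = mult_generator_half_power(2)[OF assms(1)]
  \<comment> \<open>The removed element 1 lies in the fibre only when \<open>s = 1\<close>, which is
    where \<open>m - 1\<close> comes from.\<close>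
  have "?A 1 \<union> ?A (- 1) = {x. x ^ m = s} - {1}"
  proof (intro equalityI subsetI)
    fix x assume "x \<in> {x::'a. x ^ m = s} - {1}"
    thus "x \<in> ?A 1 \<union> ?A (- 1)"
      using character_cases[of "1 - x"] by auto
  qed (use m in \<open>auto simp: power_0_left\<close>)
  moreover have "card (?A 1 \<union> ?A (- 1)) = card (?A 1) + card (?A (- 1))"
    using neq by (intro card_Un_disjoint) auto
  ultimately have "character_count s 1 + character_count s (- 1) = card ({x::'a. x ^ m = s} - {1})"
    by (simp add: character_count_def)
  thus ?thesis
    using card_character_fibre[OF assms] s neq by (auto simp: card_Diff_singleton_if)
qed

text \<open>Sending a dot to \<open>a ^ i\<close> is injective, since the row fixes
  \<open>b ^ j = 1 - a ^ i\<close> and hence the column. It is onto because x and 1 - x both avoid 0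
  and 1.\<close>

lemma card_golomb_costas_array_character:
  fixes a b s t :: 'a
  assumes a: "mult_generator a" and b: "mult_generator b"
    and s: "s = 1 \<or> s = - 1" and t: "t = 1 \<or> t = - 1"
  shows "card {(i, j) \<in> golomb_costas_array a b. (a ^ i) ^ m = s \<and> (b ^ j) ^ m = t}
    = character_count s t"
proof -
  let ?I = "{1..CARD('a) - 2}"
  let ?D = "{(i, j) \<in> golomb_costas_array a b. (a ^ i) ^ m = s \<and> (b ^ j) ^ m = t}"
  let ?A = "{x::'a. x ^ m = s \<and> (1 - x) ^ m = t}"
  note bij_a = mult_generator_bij_betw_non_1[OF a] and bij_b = mult_generator_bij_betw_non_1[OF b]
  have compl: "b ^ j = 1 - a ^ i" if "a ^ i + b ^ j = 1" for i j
    using that by (simp add: algebra_simps)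
  have inj: "inj_on (\<lambda>(i, j). a ^ i) ?D"
  proof (rule inj_onI, clarify)
    fix i j i' j'
    assume ij: "(i, j) \<in> golomb_costas_array a b" and ij': "(i', j') \<in> golomb_costas_array a b"
      and eq: "a ^ i = a ^ i'"
    have "b ^ j = b ^ j'"
      using ij ij' eq compl[of i j] compl[of i' j'] by (simp add: golomb_costas_array_def)
    with ij ij' eq show "i = i' \<and> j = j'"
      using bij_betw_imp_inj_on[OF bij_a] bij_betw_imp_inj_on[OF bij_b]
      by (auto simp: golomb_costas_array_def dest: inj_onD)
  qed
  have image: "(\<lambda>(i, j). a ^ i) ` ?D = ?A"
  proof (intro equalityI subsetI)
    fix x assume "x \<in> (\<lambda>(i, j). a ^ i) ` ?D"
    thus "x \<in> ?A"
      by (auto simp: golomb_costas_array_def dest!: compl)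
  next
    fix x assume x: "x \<in> ?A"
    hence "x \<noteq> 0" "x \<noteq> 1"
      using s t m by (auto simp: power_0_left)
    hence "x \<in> UNIV - {0, 1}" "1 - x \<in> UNIV - {0, 1}"
      by auto
    hence "x \<in> (\<lambda>i. a ^ i) ` ?I" "1 - x \<in> (\<lambda>j. b ^ j) ` ?I"
      unfolding bij_betw_imp_surj_on[OF bij_a] bij_betw_imp_surj_on[OF bij_b] .
    then obtain i j where "i \<in> ?I" "x = a ^ i" "j \<in> ?I" "1 - x = b ^ j"
      by (elim imageE)
    moreover from this have "a ^ i + b ^ j = 1"
      by (metis add.commute diff_add_cancel)
    ultimately show "x \<in> (\<lambda>(i, j). a ^ i) ` ?D"
      using x by (intro image_eqI[of _ _ "(i, j)"]) (auto simp: golomb_costas_array_def)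
  qed
  show ?thesis
    unfolding character_count_def using card_image[OF inj, unfolded image] by (rule sym)
qed

lemma golomb_costas_array_parity_counts:
  fixes a b :: 'a
  assumes a: "mult_generator a" and b: "mult_generator b"
  defines "C \<equiv> golomb_costas_array a b"
  shows "num_ee C = character_count 1 1" and "num_oo C = character_count (- 1) (- 1)"
    and "num_eo C = character_count 1 (- 1)" and "num_oe C = character_count (- 1) 1"
  using card_golomb_costas_array_character[OF a b, of 1 1]
    card_golomb_costas_array_character[OF a b, of 1 "- 1"]
    card_golomb_costas_array_character[OF a b, of "- 1" 1]
    card_golomb_costas_array_character[OF a b, of "- 1" "- 1"]
  by (simp_all add: C_def num_ee_def num_oo_def num_eo_def num_oe_def
      mult_generator_power_character[OF a] mult_generator_power_character[OF b])

end

theorem theorem9: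
  fixes \<alpha> \<beta> :: "'a::{field,finite}" and p n q :: nat and C :: "(nat \<times> nat) set"
  assumes "prime p" and "odd p" and "n \<ge> 1" and "q = p ^ n"
    and "CARD('a) = q"
    and "mult_generator \<alpha>" and "mult_generator \<beta>"
    and "C = golomb_costas_array \<alpha> \<beta>"
  shows "([q = 1] (mod 4) \<longrightarrow>
            real (num_ee C) = (real q - 5) / 4 \<and>
            real (num_oo C) = (real q - 1) / 4 \<and>
            real (num_eo C) = (real q - 1) / 4 \<and>
            real (num_oe C) = (real q - 1) / 4)
       \<and> ([q = 3] (mod 4) \<longrightarrow>
            real (num_ee C) = (real q - 3) / 4 \<and>
            real (num_eo C) = (real q - 3) / 4 \<and>
            real (num_oe C) = (real q - 3) / 4 \<and>
            real (num_oo C) = (real q + 1) / 4)"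
proof -
  have "odd q"
    using assms by simp
  moreover have "q \<ge> 2"
    using card_mono[of UNIV "{0, 1::'a}"] assms by simp
  ultimately obtain m where q: "q = 2 * m + 1" and m: "m > 0"
    by (elim oddE) auto
  have card: "CARD('a) = 2 * m + 1"
    using assms q by simp
  let ?N = "character_count m :: 'a \<Rightarrow> 'a \<Rightarrow> nat"
  note neq = mult_generator_half_power(2)[OF card m \<open>mult_generator \<alpha>\<close>]
  note counts = golomb_costas_array_parity_counts[OF card m \<open>mult_generator \<alpha>\<close> \<open>mult_generator \<beta>\<close>,
      folded \<open>C = golomb_costas_array \<alpha> \<beta>\<close>]
  have sums: "?N 1 1 + ?N 1 (- 1) = m - 1" "?N (- 1) 1 + ?N (- 1) (- 1) = m"
    using character_count_add[OF card m \<open>mult_generator \<alpha>\<close>, of 1]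
      character_count_add[OF card m \<open>mult_generator \<alpha>\<close>, of "- 1"] neq by auto
  have sym: "?N 1 (- 1) = ?N (- 1) 1"
    by (rule character_count_commute[OF card m])
  show ?thesis
  proof (intro conjI[of "_ \<longrightarrow> _"] impI)
    assume "[q = 1] (mod 4)"
    hence "even m"
      unfolding q cong_def by presburger
    \<comment> \<open>For even \<open>m\<close> the twist is nontrivial at \<open>s = - 1\<close>:
      both counts are \<open>m / 2\<close>, and so is \<open>?N 1 (- 1)\<close> by symmetry, leaving
      \<open>m / 2 - 1\<close> for \<open>?N 1 1\<close>.\<close>
    hence "?N (- 1) 1 = ?N (- 1) (- 1)"
      using character_count_inverse[OF card m, of "- 1" 1] by simp
    with sums sym \<open>even m\<close> m q show "real (num_ee C) = (real q - 5) / 4 \<and>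
        real (num_oo C) = (real q - 1) / 4 \<and> real (num_eo C) = (real q - 1) / 4 \<and>
        real (num_oe C) = (real q - 1) / 4"
      unfolding counts by auto
  next
    assume "[q = 3] (mod 4)"
    hence "odd m"
      unfolding q cong_def by presburger
    \<comment> \<open>For odd \<open>m\<close> the twist is nontrivial at \<open>s = 1\<close>
      instead: both counts are \<open>(m - 1) / 2\<close>, leaving \<open>(m + 1) / 2\<close> for
      \<open>?N (- 1) (- 1)\<close>.\<close>
    hence "?N 1 1 = ?N 1 (- 1)"
      using character_count_inverse[OF card m, of 1 1] by simp
    with sums sym \<open>odd m\<close> m q show "real (num_ee C) = (real q - 3) / 4 \<and>
        real (num_eo C) = (real q - 3) / 4 \<and> real (num_oe C) = (real q - 3) / 4 \<and>
        real (num_oo C) = (real q + 1) / 4"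
      unfolding counts by auto
  qed
qed

end
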